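(* For each $n \geq 1$, let $\theta_1^{(n)},\ldots,\theta_n^{(n)}$ be random variables taking values in $[0,2\pi)$ (not assumed independent or identically distributed), and set $$p_n(z) := \prod_{j=1}^n \left(z - e^{i\theta_j^{(n)}}\right).$$ Assume: (i) $$\lim_{\delta\searrow 0}\limsup_{n\to\infty}\mathbb{P}\left(\left|\sum_{j=1}^n e^{-i\theta_j^{(n)}}\right|\leq\delta\right)=0;$$ (ii) for (Lebesgue) almost every $z\in\mathbb{D}:=\{w\in\mathbb{C}:|w|<1\}$, $$\frac1n\log\left|\sum_{j=1}^n\frac{1}{z-e^{i\theta_j^{(n)}}}\right|\longrightarrow 0$$ in probability as $n\to\infty$; (iii) for all integers $m\geq 1$, $\frac1n\sum_{j=1}^n e^{i\theta_j^{(n)}m}\to 0$ in probability as $n\to\infty$. Then the empirical measure $\mu_{p_n}'$ of the critical points of $p_n$ converges weakly in probability as $n\to\infty$ to the uniform probability distribution on the unit circle centered at the origin in $\mathbb{C}$.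
   Context: A critical point of a polynomial is a root of its derivative. For a polynomial $f$ of degree $d\ge1$, $\mu_f:=\frac1d\sum_{z\in\mathbb{C}:f(z)=0}\mathcal{N}_f(z)\,\delta_z$, where $\mathcal{N}_f(z)$ is the multiplicity of the zero $z$ and $\delta_z$ the unit point mass; $\mu_{p_n}':=\mu_{p_n'}$ (defined for $n\ge2$). Convention: $\log 0=-\infty$. Random probability measures $\mu_n$ on $\mathbb{C}$ converge weakly in probability to a probability measure $\mu$ on $\mathbb{C}$ if for every bounded continuous $f:\mathbb{C}\to\mathbb{R}$ and every $\varepsilon>0$, $\lim_{n\to\infty}\mathbb{P}\left(\left|\int f\,d\mu_n-\int f\,d\mu\right|>\varepsilon\right)=0$. *)

theory Defs
  imports
    "HOL-Probability.Probability"
    "HOL-Computational_Algebra.Computational_Algebra"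
begin

definition zeros_measure :: "complex poly \<Rightarrow> complex measure" where
  "zeros_measure p =
     distr (point_measure {z. poly p z = 0} (\<lambda>z. ennreal (real (order z p) / real (degree p))))
           borel (\<lambda>z. z)"

definition critical_measure :: "complex poly \<Rightarrow> complex measure" where
  "critical_measure p = zeros_measure (pderiv p)"

definition circle_uniform :: "complex measure" where
  "circle_uniform = distr (uniform_measure lborel {0..<2 * pi}) borel cis"

text \<open>The library's \<^const>\<open>ln\<close> satisfies \<^prop>\<open>ln (0::real) = 0\<close>; here the logarithm of \<open>0\<close> is \<open>-\<infinity>\<close>.\<close>

definition ereal_ln :: "real \<Rightarrow> ereal" where
  "ereal_ln x = (if x > 0 then ereal (ln x) else -\<infinity>)"

text \<open>
  The limits below are constants, so the \<open>n\<close>-th random quantity may live on its own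
  probability space \<open>M n\<close>; a common space is the case of constant \<open>M\<close>.
\<close>

definition tendsto_in_prob ::
    "(nat \<Rightarrow> 'a measure) \<Rightarrow> (nat \<Rightarrow> 'a \<Rightarrow> 'b::metric_space) \<Rightarrow> 'b \<Rightarrow> bool" where
  "tendsto_in_prob M X c \<longleftrightarrow>
     (\<forall>\<epsilon>>0. (\<lambda>n. measure (M n) {\<omega> \<in> space (M n). dist (X n \<omega>) c > \<epsilon>}) \<longlonglongrightarrow> 0)"

text \<open>Extended-real version with a finite limit; the values \<open>\<plusminus>\<infinity>\<close> count as deviating from it.\<close>

definition tendsto_in_prob_ereal ::
    "(nat \<Rightarrow> 'a measure) \<Rightarrow> (nat \<Rightarrow> 'a \<Rightarrow> ereal) \<Rightarrow> real \<Rightarrow> bool" where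
  "tendsto_in_prob_ereal M X c \<longleftrightarrow>
     (\<forall>\<epsilon>>0. (\<lambda>n. measure (M n) {\<omega> \<in> space (M n). \<bar>X n \<omega> - ereal c\<bar> > ereal \<epsilon>}) \<longlonglongrightarrow> 0)"

text \<open>
  Meant for random measures, i.e. for \<open>\<mu>\<close> such that \<open>\<omega> \<mapsto> integral\<^sup>L (\<mu> n \<omega>) f\<close> is measurable.
  The zeros of a polynomial of fixed degree depend continuously on its coefficients, so this
  holds for the zeros of a polynomial of fixed degree with random coefficients.
\<close>

definition weakly_tendsto_in_prob ::
    "(nat \<Rightarrow> 'a measure) \<Rightarrow> (nat \<Rightarrow> 'a \<Rightarrow> complex measure) \<Rightarrow> complex measure \<Rightarrow> bool" where
  "weakly_tendsto_in_prob M \<mu> \<nu> \<longleftrightarrow>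
     (\<forall>f :: complex \<Rightarrow> real. continuous_on UNIV f \<and> bounded (range f) \<longrightarrow>
        tendsto_in_prob M (\<lambda>n \<omega>. integral\<^sup>L (\<mu> n \<omega>) f) (integral\<^sup>L \<nu> f))"

lemma sets_zeros_measure [simp, measurable_cong]: "sets (zeros_measure p) = sets borel"
  by (simp add: zeros_measure_def)

lemma integral_zeros_measure:
  fixes f :: "complex \<Rightarrow> real"
  assumes "p \<noteq> 0" and [measurable]: "f \<in> borel_measurable borel"
  shows "integral\<^sup>L (zeros_measure p) f =
           (\<Sum>z | poly p z = 0. real (order z p) * f z) / real (degree p)"
proof -
  have fin: "finite {z. poly p z = 0}"
    using assms(1) by (rule poly_roots_finite)
  have "integral\<^sup>L (zeros_measure p) f =
      integral\<^sup>L (point_measure {z. poly p z = 0}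
        (\<lambda>z. ennreal (real (order z p) / real (degree p)))) f"
    unfolding zeros_measure_def by (subst integral_distr) (auto simp: fin)
  also have "\<dots> = (\<Sum>z | poly p z = 0. (real (order z p) / real (degree p)) * f z)"
    by (subst lebesgue_integral_point_measure_finite) (auto simp: fin)
  finally show ?thesis
    by (simp add: sum_divide_distrib)
qed

lemma prob_space_zeros_measure:
  assumes "degree p \<ge> 1"
  shows "prob_space (zeros_measure p)"
proof
  have "p \<noteq> 0" using assms by auto
  then have fin: "finite {z. poly p z = 0}"
    by (rule poly_roots_finite)
  have "(\<Sum>z | poly p z = 0. order z p) = size (proots p)"
    using \<open>p \<noteq> 0\<close> by (simp add: size_multiset_overloaded_eq)
  then have deg: "(\<Sum>z | poly p z = 0. order z p) = degree p"
    by (simp add: size_proots_complex)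
  have "emeasure (zeros_measure p) (space (zeros_measure p)) =
      (\<Sum>z | poly p z = 0. ennreal (real (order z p) / real (degree p)))"
    unfolding zeros_measure_def
    by (subst emeasure_distr) (auto simp: fin emeasure_point_measure_finite space_point_measure)
  also have "\<dots> = ennreal (real (\<Sum>z | poly p z = 0. order z p) / real (degree p))"
    by (subst sum_ennreal) (auto simp: sum_divide_distrib)
  finally show "emeasure (zeros_measure p) (space (zeros_measure p)) = 1"
    using assms unfolding deg by simp
qed

lemma prob_space_circle_uniform: "prob_space circle_uniform"
proof -
  have "prob_space (uniform_measure lborel {0..<2 * pi})"
    by (rule prob_space_uniform_measure) auto
  moreover have "cis \<in> borel_measurable borel"
    by (intro borel_measurable_continuous_onI continuous_intros)
  ultimately show ?thesis
    unfolding circle_uniform_def by (intro prob_space.prob_space_distr) auto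
qed

end

theory Submission
  imports Defs "HOL-Real_Asymp.Real_Asymp"
begin

text \<open>
  Write \<open>w\<close> for the roots of a polynomial \<open>p\<close> of degree \<open>n\<close>, all of modulus \<open>1\<close>, and \<open>\<xi>\<close> for its
  \<open>n - 1\<close> critical points, which lie in the closed unit disc by Gauss-Lucas. Two facts about them
  imply that they are nearly uniformly distributed on the circle.

  They approach the circle. Evaluating \<open>p' / p\<close> at the origin in two ways gives
  \<open>\<bar>\<Sum> 1 / w\<bar> = n \<Prod> \<bar>\<xi>\<bar>\<close> (\<open>norm_sum_inverse_roots_eq\<close>). If the left-hand side is at least \<open>\<delta>\<close>, the
  number \<open>N\<close> of critical points of modulus below \<open>r < 1\<close> satisfies \<open>\<delta> \<le> n r\<^sup>N\<close>, whence \<open>N\<close> is only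
  of order \<open>log n\<close> (\<open>number_of_small_critical_points\<close>). Since \<open>1 / w\<close> is the conjugate of \<open>w\<close>,
  assumption (i) provides this lower bound up to a small probability.

  Their moments are asymptotically those of the uniform distribution. Newton's identities for \<open>p\<close>
  and \<open>p'\<close>, written as an equation of formal power series, show that the \<open>m\<close>-th power sums of
  \<open>w\<close> and of \<open>\<xi>\<close> differ by less than \<open>2\<^sup>m\<close>, whatever \<open>n\<close> is (\<open>power_sum_critical_points_close\<close>). Hence
  assumption (iii) on the roots passes to the critical points.

  To combine them, approximate a continuous function near the circle by \<open>Re q\<close> with a complex
  polynomial \<open>q\<close> (\<open>Re_poly_approximation_near_circle\<close>). The mean of \<open>Re q\<close> over the critical points
  is determined by their moments and is close to \<open>Re (coeff q 0)\<close>, the mean of \<open>Re q\<close> over the circle;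
  the critical points at which the approximation fails are too few to matter. These steps are
  deterministic and quantitative (\<open>critical_measure_close_to_uniform\<close>), so that in the random setting
  it suffices to bound the probability of finitely many exceptional events.
\<close>

section \<open>The logarithmic derivative and the Gauss-Lucas theorem for the unit disc\<close>

lemma poly_pderiv_eq_sum_inverse:
  fixes p :: "complex poly"
  assumes "poly p z \<noteq> 0"
  shows "poly (pderiv p) z = poly p z * (\<Sum>w\<in>#proots p. 1 / (z - w))"
proof -
  define f where "f A = (\<Prod>w\<in>#A. [:-w, 1:] :: complex poly)" for A
  have "poly (f A) z \<noteq> 0 \<Longrightarrow> poly (pderiv (f A)) z = poly (f A) z * (\<Sum>w\<in>#A. 1 / (z - w))" for A
  proof (induction A)
    case (add w A)
    have "f (add_mset w A) = [:-w, 1:] * f A" by (simp add: f_def)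
    thus ?case using add
      by (simp only: pderiv_mult poly_add poly_mult) (auto simp: pderiv_pCons field_simps)
  qed (simp add: f_def)
  moreover have p: "p = smult (lead_coeff p) (f (proots p))"
    unfolding f_def by (simp only: complex_poly_decompose_multiset)
  moreover from p have "poly p z = lead_coeff p * poly (f (proots p)) z"
    by (metis poly_smult)
  moreover from p have "poly (pderiv p) z = lead_coeff p * poly (pderiv (f (proots p))) z"
    by (metis poly_smult pderiv_smult)
  ultimately show ?thesis using assms by simp
qed

lemma Re_sum_mset: "Re (\<Sum>x\<in>#A. f x) = (\<Sum>x\<in>#A. Re (f x))"
  by (induction A) auto

lemma sum_mset_pos:
  fixes f :: "'a \<Rightarrow> real"
  assumes "A \<noteq> {#}" "\<And>x. x \<in># A \<Longrightarrow> f x > 0"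
  shows "(\<Sum>x\<in>#A. f x) > 0"
  using assms
proof (induction A)
  case (add x A)
  thus ?case by (cases "A = {#}") (auto simp: add_pos_pos)
qed simp

text \<open>
  The map \<open>u \<mapsto> 1 / (1 - u)\<close> sends the open unit disc into the right half-plane. Applied with
  \<open>u = w / z\<close>, this shows that outside the closed disc all terms of the logarithmic derivative, once
  multiplied by \<open>z\<close>, have positive real part, so that they cannot cancel.
\<close>

lemma Re_inverse_one_minus_pos:
  assumes "norm (u::complex) < 1"
  shows "Re (1 / (1 - u)) > 0"
proof -
  have "Re u < 1" using assms complex_Re_le_cmod[of u] by linarith
  hence "1 - u \<noteq> 0" by (auto simp: complex_eq_iff)
  hence "(Re (1 - u))\<^sup>2 + (Im (1 - u))\<^sup>2 > 0"
    by (metis cmod_power2 zero_less_norm_iff zero_less_power)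
  with \<open>Re u < 1\<close> show ?thesis by (simp add: Re_divide)
qed

lemma pderiv_roots_in_unit_disc:
  fixes p :: "complex poly"
  assumes "degree p \<ge> 1" and roots: "\<And>w. poly p w = 0 \<Longrightarrow> norm w \<le> 1"
    and "poly (pderiv p) z = 0"
  shows "norm z \<le> 1"
proof (rule ccontr)
  assume "\<not> norm z \<le> 1"
  hence z: "norm z > 1" "z \<noteq> 0" by auto
  hence "poly p z \<noteq> 0" using roots by force
  hence "(\<Sum>w\<in>#proots p. 1 / (z - w)) = 0"
    using assms(3) poly_pderiv_eq_sum_inverse[of p z] by simp
  hence "Re (z * (\<Sum>w\<in>#proots p. 1 / (z - w))) = 0" by simp
  also have "z * (\<Sum>w\<in>#proots p. 1 / (z - w)) = (\<Sum>w\<in>#proots p. 1 / (1 - w / z))"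
    using z by (simp add: sum_mset_distrib_left divide_simps)
  also have "Re \<dots> = (\<Sum>w\<in>#proots p. Re (1 / (1 - w / z)))"
    by (rule Re_sum_mset)
  finally have *: "(\<Sum>w\<in>#proots p. Re (1 / (1 - w / z))) = 0" .
  have pos: "Re (1 / (1 - w / z)) > 0" if "w \<in># proots p" for w
  proof (rule Re_inverse_one_minus_pos)
    have "p \<noteq> 0" using \<open>poly p z \<noteq> 0\<close> by auto
    hence "norm w \<le> 1" using that roots by simp
    thus "norm (w / z) < 1" using z by (simp add: norm_divide)
  qed
  have "proots p \<noteq> {#}" using size_proots_complex[of p] assms(1) by auto
  hence "(\<Sum>w\<in>#proots p. Re (1 / (1 - w / z))) > 0"
    by (intro sum_mset_pos pos)
  with * show False by simp
qed

section \<open>Few critical points near the origin\<close>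

lemma norm_poly_0_eq_prod_proots:
  fixes p :: "complex poly"
  shows "norm (poly p 0) = norm (lead_coeff p) * (\<Prod>w\<in>#proots p. norm w)"
proof -
  have "poly p 0 = lead_coeff p * poly (\<Prod>x\<in>#proots p. [:-x, 1:]) 0"
    by (metis complex_poly_decompose_multiset poly_smult)
  moreover have "norm (poly (\<Prod>x\<in>#A. [:-x, 1:]) 0) = (\<Prod>w\<in>#A. norm w)" for A :: "complex multiset"
    by (induction A) (auto simp: norm_mult)
  ultimately show ?thesis by (simp add: norm_mult)
qed

text \<open>
  Both sides are \<open>\<bar>p'(0)\<bar> / \<bar>p(0)\<bar>\<close>: the left one by the logarithmic derivative at \<open>0\<close>, the right one
  because the constant coefficient of a polynomial is, up to sign, its leading coefficient times
  the product of its roots, and the roots of \<open>p\<close> are unimodular.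
\<close>

lemma norm_sum_inverse_roots_eq:
  fixes p :: "complex poly"
  assumes "degree p \<ge> 1" and roots: "\<And>w. poly p w = 0 \<Longrightarrow> norm w = 1"
  shows "norm (\<Sum>w\<in>#proots p. 1 / w) = real (degree p) * (\<Prod>\<xi>\<in>#proots (pderiv p). norm \<xi>)"
proof -
  have "p \<noteq> 0" using assms by auto
  have p0: "poly p 0 \<noteq> 0" using roots[of 0] by auto
  have neg: "(\<Sum>w\<in>#proots p. 1 / (0 - w)) = - (\<Sum>w\<in>#proots p. 1 / w)"
    using sum_mset_distrib_left[of "-1 :: complex" "\<lambda>w. 1 / w" "proots p"] by simp
  have "(\<Prod>w\<in>#proots p. norm w) = (\<Prod>w\<in>#proots p. 1)"
    using \<open>p \<noteq> 0\<close> roots by (intro arg_cong[of _ _ prod_mset] image_mset_cong) auto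
  hence "norm (poly p 0) = norm (lead_coeff p)"
    by (simp add: norm_poly_0_eq_prod_proots)
  moreover have "norm (poly (pderiv p) 0) = norm (poly p 0) * norm (\<Sum>w\<in>#proots p. 1 / w)"
    using poly_pderiv_eq_sum_inverse[OF p0] unfolding neg by (simp add: norm_mult)
  moreover have "norm (poly (pderiv p) 0) =
      real (degree p) * norm (lead_coeff p) * (\<Prod>\<xi>\<in>#proots (pderiv p). norm \<xi>)"
    using assms(1) by (simp add: norm_poly_0_eq_prod_proots degree_pderiv coeff_pderiv norm_mult del: of_nat_Suc)
  ultimately show ?thesis using \<open>p \<noteq> 0\<close> by simp
qed

lemma prod_mset_le_power_small:
  fixes A :: "complex multiset"
  assumes "\<And>z. z \<in># A \<Longrightarrow> norm z \<le> 1" "0 \<le> r"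
  shows "(\<Prod>z\<in>#A. norm z) \<le> r ^ size {#z \<in># A. norm z < r#}"
  using assms(1)
proof (induction A)
  case (add x A)
  have IH: "(\<Prod>z\<in>#A. norm z) \<le> r ^ size {#z \<in># A. norm z < r#}" using add by simp
  have nn: "(\<Prod>z\<in>#A. norm z) \<ge> 0" by (induction A) auto
  show ?case
  proof (cases "norm x < r")
    case True
    thus ?thesis using IH nn assms(2) by (auto intro!: mult_mono)
  next
    case False
    have "norm x * (\<Prod>z\<in>#A. norm z) \<le> 1 * (\<Prod>z\<in>#A. norm z)"
      using add.prems nn by (intro mult_right_mono) auto
    thus ?thesis using False IH by simp
  qed
qed simp

text \<open>
  All factors of the product in \<open>norm_sum_inverse_roots_eq\<close> are at most \<open>1\<close> by Gauss-Lucas, and each of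
  the \<open>N\<close> critical points in the disc of radius \<open>r\<close> contributes a factor below \<open>r\<close>. Hence
  \<open>\<delta> \<le> n r\<^sup>N\<close>, so that \<open>N = O(log n)\<close> for fixed \<open>\<delta>\<close> and \<open>r\<close>: a vanishing proportion of the \<open>n - 1\<close>
  critical points.
\<close>

lemma number_of_small_critical_points:
  fixes p :: "complex poly"
  assumes "degree p \<ge> 1" and roots: "\<And>w. poly p w = 0 \<Longrightarrow> norm w = 1"
    and \<delta>: "0 < \<delta>" "\<delta> \<le> norm (\<Sum>w\<in>#proots p. 1 / w)" and r: "0 < r" "r < 1"
  shows "real (size {#\<xi> \<in># proots (pderiv p). norm \<xi> < r#}) \<le> ln (real (degree p) / \<delta>) / ln (1 / r)"
proof -
  let ?N = "size {#\<xi> \<in># proots (pderiv p). norm \<xi> < r#}"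
  have "pderiv p \<noteq> 0" using assms(1) by (auto simp: pderiv_eq_0_iff)
  hence "(\<Prod>\<xi>\<in>#proots (pderiv p). norm \<xi>) \<le> r ^ ?N"
    using pderiv_roots_in_unit_disc[OF assms(1)] roots r
    by (intro prod_mset_le_power_small) auto
  hence "\<delta> \<le> real (degree p) * r ^ ?N"
    using \<delta> norm_sum_inverse_roots_eq[OF assms(1) roots]
    by (smt (verit) mult_left_mono of_nat_0_le_iff)
  hence "(1 / r) ^ ?N \<le> real (degree p) / \<delta>"
    using r \<delta> by (simp add: field_simps)
  hence "ln ((1 / r) ^ ?N) \<le> ln (real (degree p) / \<delta>)"
    using r \<delta> assms(1) by (subst ln_le_cancel_iff) auto
  moreover have "ln ((1 / r) ^ ?N) = ?N * ln (1 / r)"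
    using r by (subst ln_realpow) auto
  moreover have "ln (1 / r) > 0" using r by simp
  ultimately show ?thesis by (simp add: field_simps)
qed

section \<open>Power sums of the critical points\<close>

text \<open>
  The exponents are shifted by one: this is \<open>\<Sum>\<^sub>w w / (1 - w X)\<close>, which is minus the logarithmic
  derivative of \<open>\<Prod>\<^sub>w (1 - w X)\<close>.
\<close>

definition power_sum_fps :: "complex multiset \<Rightarrow> complex fps" where
  "power_sum_fps A = Abs_fps (\<lambda>m. \<Sum>w\<in>#A. w ^ Suc m)"

text \<open>
  Newton's identities in generating-function form: \<open>reflect_poly p\<close> is \<open>\<Prod>(1 - w X)\<close> up to the leading
  coefficient. A root at \<open>0\<close> lowers the degree of the reflected polynomial but contributes the
  factor \<open>1\<close>, so no case distinction arises.
\<close>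

lemma fps_deriv_reflect_poly:
  fixes p :: "complex poly"
  defines "F \<equiv> fps_of_poly (reflect_poly p)"
  shows "fps_deriv F = - F * power_sum_fps (proots p)"
proof -
  define G where "G A = (\<Prod>w\<in>#A. 1 - fps_const w * fps_X)" for A :: "complex multiset"
  have geom: "(1 - fps_const w * fps_X) * power_sum_fps {#w#} = fps_const w" for w
  proof (rule fps_ext)
    fix m show "fps_nth ((1 - fps_const w * fps_X) * power_sum_fps {#w#}) m = fps_nth (fps_const w) m"
      by (cases m) (auto simp: power_sum_fps_def algebra_simps)
  qed
  have insert: "power_sum_fps (add_mset w A) = power_sum_fps {#w#} + power_sum_fps A" for w A
    by (rule fps_ext) (simp add: power_sum_fps_def)
  have distr: "- (a * b * c + a * (c * d)) = - (a * c) * (b + d)" for a b c d :: "complex fps"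
    by (simp add: algebra_simps)
  have deriv: "fps_deriv (G A) = - G A * power_sum_fps A" for A
  proof (induction A)
    case empty
    show ?case by (simp add: G_def power_sum_fps_def fps_eq_iff)
  next
    case (add w A)
    have "fps_deriv (G (add_mset w A)) =
        - (fps_const w * G A + (1 - fps_const w * fps_X) * (G A * power_sum_fps A))"
      using add by (simp add: G_def algebra_simps)
    also have "\<dots> = - ((1 - fps_const w * fps_X) * power_sum_fps {#w#} * G A +
          (1 - fps_const w * fps_X) * (G A * power_sum_fps A))"
      by (simp only: geom)
    also have "\<dots> = - ((1 - fps_const w * fps_X) * G A) * (power_sum_fps {#w#} + power_sum_fps A)"
      using distr[of "1 - fps_const w * fps_X"] .
    finally show ?case by (simp add: G_def insert[of w A])
  qed
  have lin: "fps_of_poly (reflect_poly [:-w, 1:]) = 1 - fps_const w * fps_X" for w :: complex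
    by (cases "w = 0") (auto simp: fps_eq_iff coeff_reflect_poly coeff_pCons split: nat.splits)
  have "fps_of_poly (reflect_poly (\<Prod>w\<in>#A. [:-w, 1:])) = G A" for A
  proof (induction A)
    case (add w A)
    thus ?case
      by (simp only: G_def image_mset_add_mset prod_mset.add_mset reflect_poly_mult fps_of_poly_mult lin)
  qed (simp add: G_def)
  hence "fps_of_poly (reflect_poly (smult (lead_coeff p) (\<Prod>w\<in>#proots p. [:-w, 1:]))) =
      fps_const (lead_coeff p) * G (proots p)"
    by (simp add: reflect_poly_smult fps_of_poly_smult)
  hence "F = fps_const (lead_coeff p) * G (proots p)"
    unfolding F_def complex_poly_decompose_multiset .
  thus ?thesis by (simp add: deriv)
qed

text \<open>
  This is the formula \<open>z p'(z) = n p(z) - X P'(X) / X\<^sup>n\<close> for \<open>z = 1 / X\<close> and \<open>P(X) = X\<^sup>n p(1 / X)\<close>.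
\<close>

lemma reflect_poly_pderiv:
  fixes p :: "complex poly"
  assumes "degree p \<ge> 1"
  shows "reflect_poly (pderiv p) =
           smult (of_nat (degree p)) (reflect_poly p) - pCons 0 (pderiv (reflect_poly p))"
proof (rule poly_eqI)
  fix i
  obtain d where d: "degree p = Suc d" using assms by (cases "degree p") auto
  have R: "coeff (pCons 0 (pderiv (reflect_poly p))) i = of_nat i * coeff (reflect_poly p) i"
    by (cases i) (auto simp: coeff_pderiv)
  show "coeff (reflect_poly (pderiv p)) i =
      coeff (smult (of_nat (degree p)) (reflect_poly p) - pCons 0 (pderiv (reflect_poly p))) i"
  proof (cases "i \<le> d")
    case True
    hence "Suc d - i = Suc (d - i)" and "(of_nat (Suc (d - i)) :: complex) = of_nat (Suc d) - of_nat i"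
      by (auto simp: of_nat_diff)
    thus ?thesis using True unfolding coeff_diff R
      by (simp add: coeff_reflect_poly degree_pderiv d coeff_pderiv left_diff_distrib del: of_nat_Suc)
  next
    case False
    thus ?thesis unfolding coeff_diff R
      by (cases "i = Suc d") (simp_all add: coeff_reflect_poly degree_pderiv d)
  qed
qed

text \<open>
  The equation is the linear recursion
  \<open>b\<^sub>m = (m + 1) a\<^sub>m\<^sub>+\<^sub>1 - \<Sum>\<^sub>i\<^sub><\<^sub>m b\<^sub>i a\<^sub>m\<^sub>-\<^sub>i\<close> for the coefficients of \<open>B\<close>. What matters below is only that
  the resulting bound depends on nothing but \<open>m\<close>.
\<close>

lemma norm_quotient_coeff_le:
  fixes A B :: "complex fps"
  assumes a0: "fps_nth A 0 = 1" and a: "\<And>m. norm (fps_nth A m) \<le> 1"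
    and eq: "fps_deriv A = A * B"
  shows "norm (fps_nth B m) \<le> 2 ^ Suc m - 1"
proof (induction m rule: less_induct)
  case (less m)
  have "of_nat (Suc m) * fps_nth A (Suc m) = (\<Sum>i\<le>m. fps_nth B i * fps_nth A (m - i))"
    using arg_cong[OF eq, of "\<lambda>F. fps_nth F m"]
    by (simp add: mult.commute[of A] fps_mult_nth atLeast0AtMost)
  also have "\<dots> = fps_nth B m + (\<Sum>i<m. fps_nth B i * fps_nth A (m - i))"
    by (simp add: lessThan_Suc_atMost[symmetric] a0)
  finally have "fps_nth B m = of_nat (Suc m) * fps_nth A (Suc m) - (\<Sum>i<m. fps_nth B i * fps_nth A (m - i))"
    by (simp add: algebra_simps)
  hence "norm (fps_nth B m) \<le> norm (of_nat (Suc m) * fps_nth A (Suc m)) +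
      norm (\<Sum>i<m. fps_nth B i * fps_nth A (m - i))"
    by (simp only: norm_triangle_ineq4)
  also have "norm (of_nat (Suc m) * fps_nth A (Suc m)) \<le> real (Suc m) * 1"
    unfolding norm_mult by (intro mult_mono a) (auto simp del: of_nat_Suc)
  also have "norm (\<Sum>i<m. fps_nth B i * fps_nth A (m - i)) \<le> (\<Sum>i<m. (2 ^ Suc i - 1) * 1)"
  proof (rule sum_norm_le)
    fix i assume "i \<in> {..<m}"
    moreover have "(1::real) \<le> 2 ^ Suc i" by (rule one_le_power) simp
    ultimately show "norm (fps_nth B i * fps_nth A (m - i)) \<le> (2 ^ Suc i - 1) * 1"
      unfolding norm_mult by (intro mult_mono a less.IH) auto
  qed
  also have "real (Suc m) * 1 + (\<Sum>i<m. ((2::real) ^ Suc i - 1) * 1) = 2 ^ Suc m - 1"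
    by (induction m) auto
  finally show ?case by simp
qed

text \<open>
  Let \<open>F\<close> and \<open>F'\<close> be the reflections of \<open>p\<close> and of its derivative, and \<open>S\<close> and \<open>S'\<close> the power sum
  series of their roots. Then \<open>F' = n F A\<close>, where the coefficients of \<open>A = 1 + X S / n\<close> are the means
  of the powers of the roots and thus bounded by \<open>1\<close>. Taking logarithmic derivatives
  shows that the derivative of \<open>A\<close> is \<open>A (S - S')\<close>. So passing from the roots to the critical
  points changes each power sum by an amount that is bounded independently of the degree.
\<close>

lemma power_sum_critical_points_close:
  fixes p :: "complex poly"
  assumes deg: "degree p \<ge> 1" and roots: "\<And>w. poly p w = 0 \<Longrightarrow> norm w \<le> 1"
  shows "norm ((\<Sum>w\<in>#proots p. w ^ Suc m) - (\<Sum>\<xi>\<in>#proots (pderiv p). \<xi> ^ Suc m)) \<le> 2 ^ Suc m - 1"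
proof -
  define n where "n = degree p"
  define F where "F = fps_of_poly (reflect_poly p)"
  define F' where "F' = fps_of_poly (reflect_poly (pderiv p))"
  define S where "S = power_sum_fps (proots p)"
  define S' where "S' = power_sum_fps (proots (pderiv p))"
  define A where "A = 1 + fps_const (1 / of_nat n) * (fps_X * S)"
  have n: "n \<ge> 1" "(of_nat n :: complex) \<noteq> 0" using deg by (auto simp: n_def)
  have "p \<noteq> 0" using deg by auto
  hence F0: "F \<noteq> 0" by (simp add: F_def fps_of_poly_eq_iff[where q = 0, simplified])
  have dF: "fps_deriv F = - F * S"
    unfolding F_def S_def by (rule fps_deriv_reflect_poly)
  have dF': "fps_deriv F' = - F' * S'"
    unfolding F'_def S'_def by (rule fps_deriv_reflect_poly)
  have cn: "fps_const (of_nat n) * fps_const (1 / of_nat n) = (1 :: complex fps)"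
    using n by (simp add: fps_const_mult)
  have "F' = fps_const (of_nat n) * F - fps_X * fps_deriv F"
    unfolding F'_def F_def reflect_poly_pderiv[OF deg]
    by (simp add: fps_of_poly_diff fps_of_poly_mult fps_of_poly_pderiv n_def fps_of_poly_smult
         fps_of_poly_pCons)
  also have "\<dots> = fps_const (of_nat n) * F + (fps_const (of_nat n) * fps_const (1 / of_nat n)) * (fps_X * (F * S))"
    by (simp only: dF cn) simp
  also have "\<dots> = fps_const (of_nat n) * (F * A)"
    unfolding A_def by (simp only: algebra_simps mult_1_left mult_1_right)
  finally have F': "F' = fps_const (of_nat n) * (F * A)" .
  have "fps_const (of_nat n) * F * fps_deriv A = fps_const (of_nat n) * F * (A * (S - S'))"
    using dF' unfolding F' by (simp add: dF algebra_simps)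
  hence eq: "fps_deriv A = A * (S - S')"
    using F0 n by simp
  have a: "norm (fps_nth A k) \<le> 1" for k
  proof (cases k)
    case (Suc j)
    have "norm (\<Sum>w\<in>#B. w ^ Suc j) \<le> real (size B)" if "\<forall>w\<in>#B. norm w \<le> 1" for B :: "complex multiset"
      using that
    proof (induction B)
      case (add x B)
      have "norm (x ^ Suc j) \<le> 1" using add.prems by (simp only: norm_power) (intro power_le_one, auto)
      thus ?case using add norm_triangle_ineq[of "x ^ Suc j" "\<Sum>w\<in>#B. w ^ Suc j"] by auto
    qed simp
    moreover have "\<forall>w\<in>#proots p. norm w \<le> 1" using \<open>p \<noteq> 0\<close> roots by simp
    ultimately have "norm (\<Sum>w\<in>#proots p. w ^ Suc j) \<le> real n"
      by (metis n_def size_proots_complex)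
    thus ?thesis using n by (simp add: A_def S_def power_sum_fps_def Suc norm_mult norm_divide)
  qed (simp add: A_def)
  have "fps_nth A 0 = 1" by (simp add: A_def)
  hence "norm (fps_nth (S - S') m) \<le> 2 ^ Suc m - 1"
    using a eq by (rule norm_quotient_coeff_le)
  thus ?thesis by (simp add: S_def S'_def power_sum_fps_def)
qed

section \<open>Integration over the circle and approximation by harmonic polynomials\<close>

lemma has_bochner_integral_cis_power:
  "has_bochner_integral lborel (\<lambda>x. indicator {0..2 * pi} x *\<^sub>R cis x ^ m)
     (if m = 0 then of_real (2 * pi) else 0)"
proof (cases "m = 0")
  case True
  have "has_bochner_integral lborel (\<lambda>x. indicator {0..2 * pi} x *\<^sub>R (1::complex))
      (of_real (2 * pi) - of_real 0)"
    by (rule has_bochner_integral_FTC_Icc[where F = of_real])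
       (auto intro!: derivative_eq_intros continuous_intros)
  thus ?thesis using True by simp
next
  case False
  define F where "F z = exp (\<i> * of_nat m * z) / (\<i> * of_nat m)" for z :: complex
  have "has_bochner_integral lborel (\<lambda>x. indicator {0..2 * pi} x *\<^sub>R cis x ^ m)
      (F (of_real (2 * pi)) - F (of_real 0))"
  proof (rule has_bochner_integral_FTC_Icc[where F = "\<lambda>x. F (of_real x)"])
    fix x :: real
    have "(F has_field_derivative exp (\<i> * of_nat m * of_real x)) (at (of_real x))"
      unfolding F_def using False by (auto intro!: derivative_eq_intros)
    also have "exp (\<i> * of_nat m * of_real x) = cis x ^ m"
      by (simp only: cis_conv_exp exp_of_nat_mult[symmetric] mult_ac)
    finally show "((\<lambda>x. F (of_real x)) has_vector_derivative cis x ^ m) (at x within {0..2 * pi})"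
      by (rule has_vector_derivative_real_field)
  qed (auto intro!: continuous_intros)
  moreover have "exp (\<i> * of_nat m * of_real (2 * pi)) = cis (2 * pi * of_nat m)"
    by (simp add: cis_conv_exp mult_ac)
  hence "F (of_real (2 * pi)) = F (of_real 0)"
    by (simp add: F_def cis_multiple_2pi)
  ultimately show ?thesis using False by simp
qed

lemma integral_circle_uniform_eq:
  fixes f :: "complex \<Rightarrow> real"
  assumes [measurable]: "f \<in> borel_measurable borel"
  shows "integral\<^sup>L circle_uniform f = (LINT x|lborel. indicator {0..2 * pi} x * f (cis x)) / (2 * pi)"
proof -
  have [measurable]: "cis \<in> borel_measurable borel"
    by (intro borel_measurable_continuous_onI continuous_intros)
  have "integral\<^sup>L circle_uniform f = (LINT x|uniform_measure lborel {0..<2 * pi}. f (cis x))"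
    unfolding circle_uniform_def by (rule integral_distr) auto
  also have "uniform_measure lborel {0..<2 * pi} =
      density lborel (\<lambda>x. ennreal (indicator {0..<2 * pi} x / (2 * pi)))"
    unfolding uniform_measure_def
    by (intro density_cong) (auto split: split_indicator simp: divide_ennreal ennreal_1[symmetric] simp del: ennreal_1)
  also have "(LINT x|\<dots>. f (cis x)) = (LINT x|lborel. (indicator {0..<2 * pi} x / (2 * pi)) *\<^sub>R f (cis x))"
    by (rule integral_density) auto
  also have "\<dots> = (LINT x|lborel. (indicator {0..2 * pi} x * f (cis x)) / (2 * pi))"
  proof (rule integral_cong_AE)
    have "AE x in lborel. x \<noteq> 2 * pi" by (rule AE_lborel_singleton)
    thus "AE x in lborel. (indicator {0..<2 * pi} x / (2 * pi)) *\<^sub>R f (cis x) =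
        (indicator {0..2 * pi} x * f (cis x)) / (2 * pi)"
      by eventually_elim (auto split: split_indicator)
  qed auto
  finally show ?thesis by simp
qed

text \<open>
  The mean value property of the harmonic function \<open>Re q\<close>; for a polynomial it is the
  orthogonality of the characters of the circle.
\<close>

lemma integral_circle_uniform_Re_poly:
  "integral\<^sup>L circle_uniform (\<lambda>z. Re (poly q z)) = Re (coeff q 0)"
proof -
  have "has_bochner_integral lborel
      (\<lambda>x. \<Sum>m\<le>degree q. coeff q m * (indicator {0..2 * pi} x *\<^sub>R cis x ^ m))
      (\<Sum>m\<le>degree q. coeff q m * (if m = 0 then of_real (2 * pi) else 0))"
    by (intro has_bochner_integral_sum has_bochner_integral_mult_right has_bochner_integral_cis_power)
  also have "(\<lambda>x. \<Sum>m\<le>degree q. coeff q m * (indicator {0..2 * pi} x *\<^sub>R cis x ^ m)) =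
      (\<lambda>x. indicator {0..2 * pi} x *\<^sub>R poly q (cis x))"
    by (rule ext) (simp add: poly_altdef scaleR_sum_right)
  also have "(\<Sum>m\<le>degree q. coeff q m * (if m = 0 then of_real (2 * pi) else 0)) =
      coeff q 0 * of_real (2 * pi)"
    by (subst sum.remove[of _ 0]) auto
  finally have "has_bochner_integral lborel (\<lambda>x. Re (indicator {0..2 * pi} x *\<^sub>R poly q (cis x)))
      (Re (coeff q 0 * of_real (2 * pi)))"
    by (rule has_bochner_integral_Re)
  hence "(LINT x|lborel. indicator {0..2 * pi} x * Re (poly q (cis x))) = Re (coeff q 0 * of_real (2 * pi))"
    by (intro has_bochner_integral_integral_eq) simp
  moreover have "(\<lambda>z. Re (poly q z)) \<in> borel_measurable borel"
    by (intro borel_measurable_continuous_onI continuous_intros)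
  ultimately show ?thesis by (simp add: integral_circle_uniform_eq)
qed

text \<open>
  On the circle \<open>z\<^sup>i cnj (z\<^sup>j)\<close> is \<open>z\<^sup>i\<^sup>-\<^sup>j\<close> or the conjugate of \<open>z\<^sup>j\<^sup>-\<^sup>i\<close>, so real parts of polynomials
  form an algebra there, although they do not on the plane. The proof reduces to \<open>Re (p cnj q)\<close>
  by \<open>Re a * Re b = Re (a b + a cnj b) / 2\<close> and peels off constant terms of both factors
  at once, cancelling \<open>z cnj z = 1\<close>.
\<close>

lemma Re_mult_Re_poly_on_circle:
  "\<exists>s. \<forall>z. norm z = 1 \<longrightarrow> Re (poly p z) * Re (poly q z) = Re (poly s z)"
proof -
  have "\<exists>s. \<forall>z. norm z = 1 \<longrightarrow> Re (poly p z * cnj (poly q z)) = Re (poly s z)"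
  proof (induction p q rule: poly_induct2)
    case 0
    show ?case by (intro exI[of _ 0]) simp
  next
    case (pCons a p b q)
    then obtain s where s: "\<And>z. norm z = 1 \<Longrightarrow> Re (poly p z * cnj (poly q z)) = Re (poly s z)"
      by blast
    define t where "t = [:a * cnj b:] + smult (cnj b) (pCons 0 p) + smult (cnj a) (pCons 0 q) + s"
    have "Re (poly (pCons a p) z * cnj (poly (pCons b q) z)) = Re (poly t z)" if "norm z = 1" for z
    proof -
      have zz: "z * cnj z = 1" using that by (simp add: complex_norm_square[symmetric])
      have "poly (pCons a p) z * cnj (poly (pCons b q) z) =
          a * cnj b + cnj b * (z * poly p z) + cnj (cnj a * (z * poly q z)) +
          (z * cnj z) * (poly p z * cnj (poly q z))"
        by (simp add: algebra_simps)
      hence "Re (poly (pCons a p) z * cnj (poly (pCons b q) z)) =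
          Re (a * cnj b) + Re (cnj b * (z * poly p z)) + Re (cnj a * (z * poly q z)) + Re (poly s z)"
        unfolding zz by (simp only: plus_complex.sel cnj.sel mult_1_left s[OF that])
      also have "\<dots> = Re (a * cnj b + cnj b * (z * poly p z) + cnj a * (z * poly q z) + poly s z)"
        by (simp only: plus_complex.sel)
      also have "a * cnj b + cnj b * (z * poly p z) + cnj a * (z * poly q z) + poly s z = poly t z"
        by (simp add: t_def algebra_simps)
      finally show ?thesis .
    qed
    thus ?case by blast
  qed
  then obtain s where s: "\<And>z. norm z = 1 \<Longrightarrow> Re (poly p z * cnj (poly q z)) = Re (poly s z)"
    by blast
  have "Re (poly p z) * Re (poly q z) = Re (poly (smult (1/2) (p * q + s)) z)" if "norm z = 1" for z
  proof -
    have "Re (poly (smult (1/2) (p * q + s)) z) = (Re (poly p z * poly q z) + Re (poly s z)) / 2"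
      by simp
    also have "\<dots> = Re (poly p z) * Re (poly q z)"
      unfolding s[OF that, symmetric] by simp
    finally show ?thesis ..
  qed
  thus ?thesis by blast
qed

lemma real_polynomial_function_on_circle:
  assumes "real_polynomial_function (g :: complex \<Rightarrow> real)"
  shows "\<exists>q. \<forall>z. norm z = 1 \<longrightarrow> g z = Re (poly q z)"
  using assms
proof induction
  case (linear f)
  have "f z = Re (poly [:0, Complex (f 1) (- f \<i>):] z)" for z
  proof -
    interpret bounded_linear f by fact
    have "f z = f (Re z *\<^sub>R 1 + Im z *\<^sub>R \<i>)"
      by (rule arg_cong[of _ _ f]) (simp add: complex_eq_iff)
    also have "\<dots> = Re z * f 1 + Im z * f \<i>" by (simp only: add scaleR real_scaleR_def)
    finally show ?thesis by simp
  qed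
  thus ?case by blast
next
  case (const c)
  have "c = Re (poly [:of_real c:] z)" for z :: complex by simp
  thus ?case by blast
next
  case (add f g)
  then obtain p q where "\<And>z. norm z = 1 \<Longrightarrow> f z = Re (poly p z)" "\<And>z. norm z = 1 \<Longrightarrow> g z = Re (poly q z)"
    by blast
  hence "\<forall>z. norm z = 1 \<longrightarrow> f z + g z = Re (poly (p + q) z)" by simp
  thus ?case by blast
next
  case (mult f g)
  then obtain p q where "\<And>z. norm z = 1 \<Longrightarrow> f z = Re (poly p z)" "\<And>z. norm z = 1 \<Longrightarrow> g z = Re (poly q z)"
    by blast
  with Re_mult_Re_poly_on_circle[of p q] show ?case by auto
qed

text \<open>
  Stone-Weierstrass on the circle, extended inwards by uniform continuity. The annulus is needed
  because critical points lie close to the circle rather than on it; \<open>K\<close> controls the few that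
  do not lie in the annulus.
\<close>

lemma Re_poly_approximation_near_circle:
  fixes f :: "complex \<Rightarrow> real"
  assumes cont: "continuous_on UNIV f" and e: "e > 0"
  obtains q r K where "0 < r" "r < 1" "K \<ge> 0"
    "\<And>z. r \<le> norm z \<Longrightarrow> norm z \<le> 1 \<Longrightarrow> \<bar>f z - Re (poly q z)\<bar> \<le> e"
    "\<And>z. norm z \<le> 1 \<Longrightarrow> \<bar>f z - Re (poly q z)\<bar> \<le> K"
proof -
  have "continuous_on (sphere 0 1) f" using cont by (rule continuous_on_subset) auto
  then obtain g where g: "real_polynomial_function g" "\<And>z. z \<in> sphere 0 1 \<Longrightarrow> \<bar>f z - g z\<bar> < e / 2"
    using Stone_Weierstrass_real_polynomial_function[of "sphere 0 1" f "e / 2"] e by auto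
  from real_polynomial_function_on_circle[OF g(1)]
  obtain q where q: "\<And>z. norm z = 1 \<Longrightarrow> g z = Re (poly q z)" by blast
  define h where "h z = f z - Re (poly q z)" for z
  have h_circle: "\<bar>h z\<bar> < e / 2" if "norm z = 1" for z
    using g(2)[of z] q[OF that] that by (simp add: h_def)
  have h_cont: "continuous_on (cball 0 1) h"
    unfolding h_def by (intro continuous_intros continuous_on_subset[OF cont]) auto
  have "bounded (h ` cball 0 1)"
    by (intro compact_imp_bounded compact_continuous_image h_cont) auto
  then obtain K where "K > 0" "\<forall>z\<in>cball 0 1. \<bar>h z\<bar> \<le> K"
    unfolding bounded_pos by auto
  hence K: "K > 0" "\<And>z. norm z \<le> 1 \<Longrightarrow> \<bar>h z\<bar> \<le> K" by auto
  have "uniformly_continuous_on (cball 0 1) h"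
    by (intro compact_uniformly_continuous h_cont) auto
  then obtain d where d: "d > 0"
    "\<And>x y. norm x \<le> 1 \<Longrightarrow> norm y \<le> 1 \<Longrightarrow> dist y x < d \<Longrightarrow> dist (h y) (h x) < e / 2"
    unfolding uniformly_continuous_on_def using e by (metis half_gt_zero mem_cball_0)
  define r where "r = max (1 / 2) (1 - d / 2)"
  have r: "0 < r" "r < 1" "1 - r < d" using d(1) by (auto simp: r_def)
  have near: "\<bar>h z\<bar> \<le> e" if z: "r \<le> norm z" "norm z \<le> 1" for z
  proof -
    have nz: "norm z > 0" using z r by linarith
    define y where "y = sgn z"
    have y: "norm y = 1" using nz by (simp add: y_def norm_sgn)
    have "z = of_real (norm z) * y" using nz by (simp add: y_def sgn_eq)
    hence "z - y = of_real (norm z - 1) * y" by (simp add: algebra_simps)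
    hence "norm (z - y) = \<bar>norm z - 1\<bar> * norm y" by (metis norm_mult norm_of_real)
    hence "dist z y < d" using y z r by (simp add: dist_norm)
    hence "\<bar>h z - h y\<bar> < e / 2" using d(2)[of y z] y z by (simp add: dist_real_def)
    thus ?thesis using h_circle[OF y] by linarith
  qed
  show thesis
    by (rule that[of r K q]) (use r K near in \<open>auto simp: h_def\<close>)
qed

text \<open>
  Only the values on the circle matter, since \<open>circle_uniform\<close> is concentrated there; its
  integral of \<open>Re q\<close> is \<open>Re (coeff q 0)\<close>.
\<close>

lemma integral_circle_uniform_approx:
  fixes f :: "complex \<Rightarrow> real"
  assumes cont: "continuous_on UNIV f"
    and approx: "\<And>z. norm z = 1 \<Longrightarrow> \<bar>f z - Re (poly q z)\<bar> \<le> e"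
  shows "\<bar>integral\<^sup>L circle_uniform f - Re (coeff q 0)\<bar> \<le> e"
proof -
  interpret prob_space circle_uniform by (rule prob_space_circle_uniform)
  have [measurable]: "cis \<in> borel_measurable borel"
    by (intro borel_measurable_continuous_onI continuous_intros)
  have ae: "AE z in circle_uniform. norm z = 1"
    unfolding circle_uniform_def by (subst AE_distr_iff) auto
  have int: "integrable circle_uniform g" if g: "continuous_on UNIV g" for g :: "complex \<Rightarrow> real"
  proof -
    have "bounded (g ` sphere 0 1)"
      by (intro compact_imp_bounded compact_continuous_image continuous_on_subset[OF g]) auto
    then obtain B where "\<forall>z\<in>sphere 0 1. \<bar>g z\<bar> \<le> B" unfolding bounded_iff by auto
    hence B: "\<And>z. norm z = 1 \<Longrightarrow> \<bar>g z\<bar> \<le> B" by auto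
    have "g \<in> borel_measurable circle_uniform"
      using borel_measurable_continuous_onI[OF g] by (simp add: circle_uniform_def)
    thus ?thesis using ae B by (intro integrable_const_bound[of _ B]) (auto elim!: eventually_mono)
  qed
  have q: "continuous_on UNIV (\<lambda>z. Re (poly q z))" by (intro continuous_intros)
  have "integral\<^sup>L circle_uniform f - Re (coeff q 0) = (LINT z|circle_uniform. f z - Re (poly q z))"
    using int[OF cont] int[OF q] by (simp add: integral_circle_uniform_Re_poly)
  also have "\<bar>\<dots>\<bar> \<le> (LINT z|circle_uniform. \<bar>f z - Re (poly q z)\<bar>)"
    by (rule integral_abs_bound)
  also have "\<dots> \<le> (LINT z|circle_uniform. e)"
    using int[OF cont] int[OF q] ae approx
    by (intro integral_mono_AE) (auto elim!: eventually_mono)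
  also have "\<dots> = e" by (simp add: prob_space)
  finally show ?thesis .
qed

section \<open>The empirical measure of the critical points of a fixed polynomial\<close>

lemma sum_mset_diff_fun: "(\<Sum>x\<in>#A. f x - g x) = (\<Sum>x\<in>#A. f x) - (\<Sum>x\<in>#A. g x :: real)"
  by (induction A) auto

lemma sum_mset_eq_sum_count:
  fixes f :: "'a \<Rightarrow> real"
  assumes "finite S" "set_mset A \<subseteq> S"
  shows "(\<Sum>x\<in>#A. f x) = (\<Sum>x\<in>S. real (count A x) * f x)"
  using assms(2)
proof (induction A)
  case (add a A)
  have "real (count (add_mset a A) x) * f x = real (count A x) * f x + (if x = a then f x else 0)" for x
    by (simp add: algebra_simps)
  thus ?case using add assms(1) by (simp add: sum.distrib sum.delta)
qed simp

lemma integral_critical_measure: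
  fixes f :: "complex \<Rightarrow> real"
  assumes "degree p \<ge> 1" "continuous_on UNIV f"
  shows "integral\<^sup>L (critical_measure p) f =
           (\<Sum>\<xi>\<in>#proots (pderiv p). f \<xi>) / (real (degree p) - 1)"
proof -
  have nz: "pderiv p \<noteq> 0" using assms(1) by (auto simp: pderiv_eq_0_iff)
  have "integral\<^sup>L (critical_measure p) f =
      (\<Sum>z | poly (pderiv p) z = 0. real (order z (pderiv p)) * f z) / real (degree (pderiv p))"
    unfolding critical_measure_def using nz assms(2)
    by (intro integral_zeros_measure borel_measurable_continuous_onI)
  also have "(\<Sum>z | poly (pderiv p) z = 0. real (order z (pderiv p)) * f z) = (\<Sum>\<xi>\<in>#proots (pderiv p). f \<xi>)"
    using nz by (subst sum_mset_eq_sum_count[of "{z. poly (pderiv p) z = 0}"]) (auto simp: poly_roots_finite)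
  finally show ?thesis using assms(1) by (simp add: degree_pderiv of_nat_diff)
qed

text \<open>
  The mean of \<open>Re q\<close> over the critical points is a combination of the means of their powers. The
  zeroth power produces the limit \<open>Re (coeff q 0)\<close>; the higher ones are compared with the power
  sums of the roots.
\<close>

lemma critical_average_of_harmonic_polynomial:
  fixes p q :: "complex poly"
  assumes deg: "degree p \<ge> 2" and roots: "\<And>w. poly p w = 0 \<Longrightarrow> norm w \<le> 1"
  shows "\<bar>(\<Sum>\<xi>\<in>#proots (pderiv p). Re (poly q \<xi>)) / (real (degree p) - 1) - Re (coeff q 0)\<bar>
     \<le> (\<Sum>m=1..degree q. norm (coeff q m) * (norm (\<Sum>w\<in>#proots p. w ^ m) + 2 ^ m)) / (real (degree p) - 1)"
proof -
  let ?X = "proots (pderiv p)"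
  define N where "N = real (degree p) - 1"
  have N: "N > 0" using deg by (simp add: N_def)
  have size: "real (size ?X) = N"
    using deg by (simp add: size_proots_complex degree_pderiv N_def of_nat_diff)
  have expand: "(\<Sum>\<xi>\<in>#A. poly q \<xi>) = (\<Sum>m\<le>degree q. coeff q m * (\<Sum>\<xi>\<in>#A. \<xi> ^ m))" for A
    by (induction A) (auto simp: poly_altdef sum.distrib algebra_simps)
  have "(\<Sum>m\<le>degree q. coeff q m * (\<Sum>\<xi>\<in>#?X. \<xi> ^ m)) =
      coeff q 0 * (\<Sum>\<xi>\<in>#?X. \<xi> ^ 0) + (\<Sum>m=1..degree q. coeff q m * (\<Sum>\<xi>\<in>#?X. \<xi> ^ m))"
    by (simp add: atMost_atLeast0 sum.atLeast_Suc_atMost)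
  hence "(\<Sum>\<xi>\<in>#?X. poly q \<xi>) = of_real N * coeff q 0 + (\<Sum>m=1..degree q. coeff q m * (\<Sum>\<xi>\<in>#?X. \<xi> ^ m))"
    unfolding expand by (simp add: size[symmetric])
  hence "(\<Sum>\<xi>\<in>#?X. Re (poly q \<xi>)) - N * Re (coeff q 0) = Re (\<Sum>m=1..degree q. coeff q m * (\<Sum>\<xi>\<in>#?X. \<xi> ^ m))"
    unfolding Re_sum_mset[symmetric] by simp
  also have "\<bar>\<dots>\<bar> \<le> norm (\<Sum>m=1..degree q. coeff q m * (\<Sum>\<xi>\<in>#?X. \<xi> ^ m))"
    by (rule abs_Re_le_cmod)
  also have "\<dots> \<le> (\<Sum>m=1..degree q. norm (coeff q m) * (norm (\<Sum>w\<in>#proots p. w ^ m) + 2 ^ m))"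
  proof (rule sum_norm_le)
    fix m assume "m \<in> {1..degree q}"
    then obtain k where k: "m = Suc k" by (cases m) auto
    have "norm ((\<Sum>w\<in>#proots p. w ^ m) - (\<Sum>\<xi>\<in>#?X. \<xi> ^ m)) \<le> 2 ^ m - 1"
      unfolding k using deg roots by (intro power_sum_critical_points_close) auto
    hence "norm (\<Sum>\<xi>\<in>#?X. \<xi> ^ m) \<le> norm (\<Sum>w\<in>#proots p. w ^ m) + 2 ^ m"
      using norm_triangle_ineq2[of "\<Sum>\<xi>\<in>#?X. \<xi> ^ m" "\<Sum>w\<in>#proots p. w ^ m"]
      by (simp add: norm_minus_commute)
    thus "norm (coeff q m * (\<Sum>\<xi>\<in>#?X. \<xi> ^ m)) \<le>
        norm (coeff q m) * (norm (\<Sum>w\<in>#proots p. w ^ m) + 2 ^ m)"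
      unfolding norm_mult by (rule mult_left_mono) auto
  qed
  finally have *: "\<bar>(\<Sum>\<xi>\<in>#?X. Re (poly q \<xi>)) - N * Re (coeff q 0)\<bar> \<le>
    (\<Sum>m=1..degree q. norm (coeff q m) * (norm (\<Sum>w\<in>#proots p. w ^ m) + 2 ^ m))" .
  have "(\<Sum>\<xi>\<in>#?X. Re (poly q \<xi>)) / N - Re (coeff q 0) =
      ((\<Sum>\<xi>\<in>#?X. Re (poly q \<xi>)) - N * Re (coeff q 0)) / N"
    using N by (simp add: diff_divide_distrib)
  thus ?thesis using * N unfolding N_def[symmetric] by (simp add: abs_divide divide_right_mono)
qed

lemma sum_mset_deviation_le:
  fixes h :: "complex \<Rightarrow> real"
  assumes near: "\<And>z. r \<le> norm z \<Longrightarrow> norm z \<le> 1 \<Longrightarrow> \<bar>h z\<bar> \<le> e"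
    and bound: "\<And>z. norm z \<le> 1 \<Longrightarrow> \<bar>h z\<bar> \<le> K" and "e \<ge> 0"
    and disc: "\<And>z. z \<in># A \<Longrightarrow> norm z \<le> 1"
  shows "\<bar>\<Sum>z\<in>#A. h z\<bar> \<le> e * size A + K * size {#z \<in># A. norm z < r#}"
  using disc
proof (induction A)
  case (add x A)
  have "\<bar>h x\<bar> \<le> e + K * (if norm x < r then 1 else 0)"
    using near[of x] bound[of x] add.prems[of x] \<open>e \<ge> 0\<close> by (cases "norm x < r") auto
  moreover have "\<bar>\<Sum>z\<in>#A. h z\<bar> \<le> e * size A + K * size {#z \<in># A. norm z < r#}"
    using add by simp
  ultimately show ?case by (auto simp: algebra_simps split: if_splits)
qed simp

text \<open>
  The deterministic core: \<open>D\<close> and \<open>\<eta>\<close> say which power sums of the roots must be small and how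
  small. They depend on \<open>f\<close> and \<open>\<epsilon>\<close> but not on \<open>\<delta>\<close>, which only influences how large the degree has
  to be. This order of quantifiers allows \<open>\<delta>\<close> to be chosen last, according to the
  probability that is to be exceptional.
\<close>

lemma critical_measure_close_to_uniform:
  fixes f :: "complex \<Rightarrow> real"
  assumes cont: "continuous_on UNIV f" and \<epsilon>: "\<epsilon> > 0"
  obtains D \<eta> where "\<eta> > 0"
    "\<And>\<delta>. \<delta> > 0 \<Longrightarrow> \<forall>\<^sub>F n in sequentially. \<forall>p. degree p = n \<longrightarrow> (\<forall>w. poly p w = 0 \<longrightarrow> norm w = 1) \<longrightarrow>
       \<delta> \<le> norm (\<Sum>w\<in>#proots p. 1 / w) \<longrightarrow>
       (\<forall>m\<in>{1..D}. norm (\<Sum>w\<in>#proots p. w ^ m) \<le> \<eta> * real n) \<longrightarrow>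
       \<bar>integral\<^sup>L (critical_measure p) f - integral\<^sup>L circle_uniform f\<bar> \<le> \<epsilon>"
proof -
  define e where "e = \<epsilon> / 6"
  have e: "e > 0" using \<epsilon> by (simp add: e_def)
  obtain q r K where qrK: "0 < r" "r < 1" "K \<ge> 0"
    "\<And>z. r \<le> norm z \<Longrightarrow> norm z \<le> 1 \<Longrightarrow> \<bar>f z - Re (poly q z)\<bar> \<le> e"
    "\<And>z. norm z \<le> 1 \<Longrightarrow> \<bar>f z - Re (poly q z)\<bar> \<le> K"
    using Re_poly_approximation_near_circle[OF cont e] by metis
  define D where "D = degree q"
  define C where "C = (\<Sum>m=1..D. norm (coeff q m))"
  define C2 where "C2 = (\<Sum>m=1..D. norm (coeff q m) * 2 ^ m)"
  define \<eta> where "\<eta> = e / (C + 1)"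
  have C: "C \<ge> 0" unfolding C_def by (intro sum_nonneg) auto
  have \<eta>: "\<eta> > 0" "\<eta> * C \<le> e" using e C by (auto simp: \<eta>_def field_simps)
  \<comment> \<open>Of \<open>\<epsilon> = 6 e\<close>, replacing \<open>f\<close> by \<open>Re q\<close> costs \<open>2 e\<close> at the critical points and \<open>e\<close> on the circle,
      and the nonconstant powers cost \<open>3 e\<close>.\<close>
  have main: "\<bar>integral\<^sup>L (critical_measure p) f - integral\<^sup>L circle_uniform f\<bar> \<le> \<epsilon>"
    if \<delta>: "\<delta> > 0" and n: "degree p = n" "n \<ge> 2"
      and small: "K * (ln (real n / \<delta>) / ln (1 / r)) / (real n - 1) \<le> e" "C2 / (real n - 1) \<le> e"
      and roots: "\<forall>w. poly p w = 0 \<longrightarrow> norm w = 1"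
      and lower: "\<delta> \<le> norm (\<Sum>w\<in>#proots p. 1 / w)"
      and moments: "\<forall>m\<in>{1..D}. norm (\<Sum>w\<in>#proots p. w ^ m) \<le> \<eta> * real n" for \<delta> n p
  proof -
    let ?X = "proots (pderiv p)"
    define N where "N = real n - 1"
    have N: "N > 0" "real n \<le> 2 * N" using n by (auto simp: N_def)
    have size: "real (size ?X) = N"
      using n by (simp add: size_proots_complex degree_pderiv N_def of_nat_diff)
    have nz: "pderiv p \<noteq> 0" using n by (auto simp: pderiv_eq_0_iff)
    have int: "integral\<^sup>L (critical_measure p) f = (\<Sum>\<xi>\<in>#?X. f \<xi>) / N"
      using n by (simp add: integral_critical_measure cont N_def)
    have "\<bar>\<Sum>\<xi>\<in>#?X. f \<xi> - Re (poly q \<xi>)\<bar> \<le> e * size ?X + K * size {#\<xi> \<in># ?X. norm \<xi> < r#}"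
      using qrK e nz n roots by (intro sum_mset_deviation_le) (auto intro: pderiv_roots_in_unit_disc[of p])
    also have "K * real (size {#\<xi> \<in># ?X. norm \<xi> < r#}) \<le> K * (ln (real n / \<delta>) / ln (1 / r))"
      using number_of_small_critical_points[of p \<delta> r] n roots lower \<delta> qrK
      by (intro mult_left_mono) auto
    also have "\<dots> \<le> e * N"
      using small(1) N by (simp only: N_def[symmetric] pos_divide_le_eq)
    finally have "\<bar>(\<Sum>\<xi>\<in>#?X. f \<xi>) - (\<Sum>\<xi>\<in>#?X. Re (poly q \<xi>))\<bar> \<le> 2 * e * N"
      by (simp add: sum_mset_diff_fun size mult_ac)
    hence 1: "\<bar>(\<Sum>\<xi>\<in>#?X. f \<xi>) / N - (\<Sum>\<xi>\<in>#?X. Re (poly q \<xi>)) / N\<bar> \<le> 2 * e"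
      using N by (simp add: diff_divide_distrib[symmetric] abs_divide field_simps)
    have "\<bar>(\<Sum>\<xi>\<in>#?X. Re (poly q \<xi>)) / N - Re (coeff q 0)\<bar>
       \<le> (\<Sum>m=1..D. norm (coeff q m) * (norm (\<Sum>w\<in>#proots p. w ^ m) + 2 ^ m)) / N"
      using critical_average_of_harmonic_polynomial[of p q] n roots by (simp add: D_def N_def)
    also have "\<dots> \<le> (\<Sum>m=1..D. norm (coeff q m) * (\<eta> * (2 * N) + 2 ^ m)) / N"
    proof (intro divide_right_mono sum_mono mult_left_mono add_right_mono)
      fix m assume "m \<in> {1..D}"
      hence "norm (\<Sum>w\<in>#proots p. w ^ m) \<le> \<eta> * real n" using moments by blast
      also have "\<dots> \<le> \<eta> * (2 * N)" using \<eta> N by (intro mult_left_mono) auto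
      finally show "norm (\<Sum>w\<in>#proots p. w ^ m) \<le> \<eta> * (2 * N)" .
    qed (use N in auto)
    also have "(\<Sum>m=1..D. norm (coeff q m) * (\<eta> * (2 * N) + 2 ^ m)) = \<eta> * C * (2 * N) + C2"
      by (simp add: C_def C2_def algebra_simps sum.distrib sum_distrib_left)
    also have "(\<eta> * C * (2 * N) + C2) / N = 2 * (\<eta> * C) + C2 / N" using N by (simp add: field_simps)
    also have "\<dots> \<le> 3 * e" using \<eta> small(2) by (simp add: N_def)
    finally have 2: "\<bar>(\<Sum>\<xi>\<in>#?X. Re (poly q \<xi>)) / N - Re (coeff q 0)\<bar> \<le> 3 * e" .
    have 3: "\<bar>integral\<^sup>L circle_uniform f - Re (coeff q 0)\<bar> \<le> e"
      using qrK by (intro integral_circle_uniform_approx cont) auto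
    show ?thesis using 1 2 3 e unfolding int e_def by linarith
  qed
  have ev: "\<forall>\<^sub>F n in sequentially. \<forall>p. degree p = n \<longrightarrow> (\<forall>w. poly p w = 0 \<longrightarrow> norm w = 1) \<longrightarrow>
       \<delta> \<le> norm (\<Sum>w\<in>#proots p. 1 / w) \<longrightarrow>
       (\<forall>m\<in>{1..D}. norm (\<Sum>w\<in>#proots p. w ^ m) \<le> \<eta> * real n) \<longrightarrow>
       \<bar>integral\<^sup>L (critical_measure p) f - integral\<^sup>L circle_uniform f\<bar> \<le> \<epsilon>" if \<delta>: "\<delta> > 0" for \<delta>
  proof -
    have "(\<lambda>n. ln (real n / \<delta>) / (real n - 1)) \<longlonglongrightarrow> 0" using \<delta> by real_asymp
    hence "(\<lambda>n. K / ln (1 / r) * (ln (real n / \<delta>) / (real n - 1))) \<longlonglongrightarrow> K / ln (1 / r) * 0"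
      by (intro tendsto_intros)
    hence "(\<lambda>n. K * (ln (real n / \<delta>) / ln (1 / r)) / (real n - 1)) \<longlonglongrightarrow> 0"
      by (simp add: mult_ac)
    hence "\<forall>\<^sub>F n in sequentially. K * (ln (real n / \<delta>) / ln (1 / r)) / (real n - 1) < e"
      using e by (rule order_tendstoD)
    moreover have "(\<lambda>n. C2 / (real n - 1)) \<longlonglongrightarrow> 0" by real_asymp
    hence "\<forall>\<^sub>F n in sequentially. C2 / (real n - 1) < e"
      using e by (rule order_tendstoD)
    moreover have "\<forall>\<^sub>F n in sequentially. n \<ge> (2::nat)" by (rule eventually_ge_at_top)
    ultimately show ?thesis
    proof eventually_elim
      case (elim n)
      thus ?case using main[OF \<delta>, of _ n] by auto
    qed
  qed
  show thesis by (rule that[OF \<eta>(1) ev])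
qed

section \<open>Convergence in probability\<close>

theorem theorem12:
  fixes M :: "nat \<Rightarrow> 'a measure"
    and \<theta> :: "nat \<Rightarrow> nat \<Rightarrow> 'a \<Rightarrow> real"
    and p :: "nat \<Rightarrow> 'a \<Rightarrow> complex poly"
  assumes prob: "\<And>n. n \<ge> 1 \<Longrightarrow> prob_space (M n)"
    and meas: "\<And>n j. 1 \<le> j \<Longrightarrow> j \<le> n \<Longrightarrow> \<theta> n j \<in> borel_measurable (M n)"
    and range: "\<And>n j \<omega>. 1 \<le> j \<Longrightarrow> j \<le> n \<Longrightarrow> \<omega> \<in> space (M n) \<Longrightarrow> \<theta> n j \<omega> \<in> {0..<2 * pi}"
    and p_def: "\<And>n \<omega>. p n \<omega> = (\<Prod>j=1..n. [:- exp (\<i> * of_real (\<theta> n j \<omega>)), 1:])"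
    and i: "((\<lambda>\<delta>::real. limsup (\<lambda>n. ereal (measure (M n)
               {\<omega> \<in> space (M n). norm (\<Sum>j=1..n. exp (- \<i> * of_real (\<theta> n j \<omega>))) \<le> \<delta>})))
             \<longlongrightarrow> 0) (at_right 0)"
    and ii: "AE z in lborel. z \<in> ball 0 1 \<longrightarrow>
               tendsto_in_prob_ereal M
                 (\<lambda>n \<omega>. ereal (1 / real n) *
                    ereal_ln (norm (\<Sum>j=1..n. 1 / (z - exp (\<i> * of_real (\<theta> n j \<omega>)))))) 0"
    and iii: "\<And>m::nat. m \<ge> 1 \<Longrightarrow>
               tendsto_in_prob M
                 (\<lambda>n \<omega>. (1 / of_nat n) * (\<Sum>j=1..n. exp (\<i> * of_real (\<theta> n j \<omega>) * of_nat m))) 0"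
  shows "weakly_tendsto_in_prob M (\<lambda>n \<omega>. critical_measure (p n \<omega>)) circle_uniform"
  unfolding weakly_tendsto_in_prob_def tendsto_in_prob_def
proof (intro allI impI, elim conjE)
  fix f :: "complex \<Rightarrow> real" and \<epsilon> :: real
  assume cont: "continuous_on UNIV f" and \<epsilon>: "\<epsilon> > 0"
  obtain D \<eta> where \<eta>: "\<eta> > 0" and close:
    "\<And>\<delta>. \<delta> > 0 \<Longrightarrow> \<forall>\<^sub>F n in sequentially. \<forall>p. degree p = n \<longrightarrow> (\<forall>w. poly p w = 0 \<longrightarrow> norm w = 1) \<longrightarrow>
       \<delta> \<le> norm (\<Sum>w\<in>#proots p. 1 / w) \<longrightarrow>
       (\<forall>m\<in>{1..D}. norm (\<Sum>w\<in>#proots p. w ^ m) \<le> \<eta> * real n) \<longrightarrow>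
       \<bar>integral\<^sup>L (critical_measure p) f - integral\<^sup>L circle_uniform f\<bar> \<le> \<epsilon>"
    using critical_measure_close_to_uniform[OF cont \<epsilon>] by blast
  define dev where "dev n = {\<omega> \<in> space (M n).
      dist (integral\<^sup>L (critical_measure (p n \<omega>)) f) (integral\<^sup>L circle_uniform f) > \<epsilon>}" for n
  define low where "low \<delta> n = {\<omega> \<in> space (M n). norm (\<Sum>j=1..n. exp (- \<i> * of_real (\<theta> n j \<omega>))) \<le> \<delta>}" for \<delta> n
  define mom where "mom m n = {\<omega> \<in> space (M n).
      dist ((1 / of_nat n) * (\<Sum>j=1..n. exp (\<i> * of_real (\<theta> n j \<omega>) * of_nat m))) 0 > \<eta>}" for m n

  have roots: "proots (p n \<omega>) = image_mset (\<lambda>j. exp (\<i> * of_real (\<theta> n j \<omega>))) (mset_set {1..n})" for n \<omega>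
    unfolding p_def
    by (subst proots_prod) (auto simp: sum_unfold_sum_mset comp_def sum_mset_singleton_mset)
  have degree: "degree (p n \<omega>) = n" for n \<omega>
    by (simp add: roots size_proots_complex[symmetric])
  have unimodular: "norm w = 1" if "poly (p n \<omega>) w = 0" for n \<omega> w
    using that by (auto simp: p_def poly_prod)
  have inverse_sum: "(\<Sum>w\<in>#proots (p n \<omega>). 1 / w) = (\<Sum>j=1..n. exp (- \<i> * of_real (\<theta> n j \<omega>)))" for n \<omega>
    by (simp add: roots sum_unfold_sum_mset comp_def image_mset.compositionality exp_minus divide_inverse)
  have power_sum: "(\<Sum>w\<in>#proots (p n \<omega>). w ^ m) = (\<Sum>j=1..n. exp (\<i> * of_real (\<theta> n j \<omega>) * of_nat m))" for n \<omega> m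
    by (simp add: roots sum_unfold_sum_mset comp_def image_mset.compositionality exp_of_nat2_mult)

  have low_sets: "low \<delta> n \<in> sets (M n)" for \<delta> n
  proof -
    have "(\<lambda>\<omega>. \<Sum>j=1..n. exp (- \<i> * of_real (\<theta> n j \<omega>))) \<in> borel_measurable (M n)"
    proof (rule borel_measurable_sum)
      fix j assume "j \<in> {1..n}"
      hence [measurable]: "\<theta> n j \<in> borel_measurable (M n)" using meas by simp
      show "(\<lambda>\<omega>. exp (- \<i> * of_real (\<theta> n j \<omega>))) \<in> borel_measurable (M n)" by measurable
    qed
    note [measurable] = this
    show ?thesis unfolding low_def by measurable
  qed
  have mom_sets: "mom m n \<in> sets (M n)" for m n
  proof -
    have "(\<lambda>\<omega>. \<Sum>j=1..n. exp (\<i> * of_real (\<theta> n j \<omega>) * of_nat m)) \<in> borel_measurable (M n)"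
    proof (rule borel_measurable_sum)
      fix j assume "j \<in> {1..n}"
      hence [measurable]: "\<theta> n j \<in> borel_measurable (M n)" using meas by simp
      show "(\<lambda>\<omega>. exp (\<i> * of_real (\<theta> n j \<omega>) * of_nat m)) \<in> borel_measurable (M n)" by measurable
    qed
    note [measurable] = this
    show ?thesis unfolding mom_def by measurable
  qed

  have dev_subset: "\<forall>\<^sub>F n in sequentially. dev n \<subseteq> low \<delta> n \<union> (\<Union>m\<in>{1..D}. mom m n)" if "\<delta> > 0" for \<delta>
    using close[OF that] eventually_ge_at_top[of "1::nat"]
  proof eventually_elim
    case (elim n)
    show ?case
    proof
      fix \<omega> assume \<omega>: "\<omega> \<in> dev n"
      show "\<omega> \<in> low \<delta> n \<union> (\<Union>m\<in>{1..D}. mom m n)"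
      proof (rule ccontr)
        assume out: "\<omega> \<notin> low \<delta> n \<union> (\<Union>m\<in>{1..D}. mom m n)"
        have sp: "\<omega> \<in> space (M n)" using \<omega> by (simp add: dev_def)
        have "\<delta> \<le> norm (\<Sum>w\<in>#proots (p n \<omega>). 1 / w)"
          using out sp by (simp add: low_def inverse_sum)
        moreover have "norm (\<Sum>w\<in>#proots (p n \<omega>). w ^ m) \<le> \<eta> * real n" if "m \<in> {1..D}" for m
          using out sp that \<open>n \<ge> 1\<close>
          by (auto simp: mom_def power_sum norm_mult norm_divide field_simps not_less)
        ultimately have "\<bar>integral\<^sup>L (critical_measure (p n \<omega>)) f - integral\<^sup>L circle_uniform f\<bar> \<le> \<epsilon>"
          using elim(1) degree unimodular by blast
        thus False using \<omega> by (simp add: dev_def dist_real_def)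
      qed
    qed
  qed

  have mom_null: "(\<lambda>n. \<Sum>m=1..D. measure (M n) (mom m n)) \<longlonglongrightarrow> 0"
  proof (rule tendsto_null_sum)
    fix m assume "m \<in> {1..D}"
    thus "(\<lambda>n. measure (M n) (mom m n)) \<longlonglongrightarrow> 0"
      using iii[of m] \<eta> unfolding tendsto_in_prob_def mom_def by auto
  qed

  have "\<forall>\<^sub>F n in sequentially. measure (M n) (dev n) < \<tau>" if \<tau>: "\<tau> > 0" for \<tau> :: real
  proof -
    \<comment> \<open>\<open>D\<close> and \<open>\<eta>\<close> are fixed at this point; \<open>\<delta>\<close> is chosen now, depending on \<open>\<tau>\<close>.\<close>
    have "\<forall>\<^sub>F \<delta> in at_right 0. limsup (\<lambda>n. ereal (measure (M n) (low \<delta> n))) < ereal (\<tau> / 2)"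
      using i \<tau> unfolding low_def by (intro order_tendstoD(2)) (auto simp: zero_ereal_def)
    moreover have "\<forall>\<^sub>F \<delta> in at_right 0. (\<delta>::real) > 0"
      by (rule eventually_at_right_less)
    ultimately have "\<forall>\<^sub>F \<delta> in at_right 0. limsup (\<lambda>n. ereal (measure (M n) (low \<delta> n))) < ereal (\<tau> / 2) \<and> (\<delta>::real) > 0"
      by (rule eventually_conj)
    then obtain \<delta> :: real where \<delta>: "\<delta> > 0" "limsup (\<lambda>n. ereal (measure (M n) (low \<delta> n))) < ereal (\<tau> / 2)"
      using eventually_happens'[OF trivial_limit_at_right_real] by blast
    have "\<forall>\<^sub>F n in sequentially. measure (M n) (low \<delta> n) < \<tau> / 2"
      using Limsup_lessD[OF \<delta>(2)] by simp
    moreover have "\<forall>\<^sub>F n in sequentially. (\<Sum>m=1..D. measure (M n) (mom m n)) < \<tau> / 2"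
      using mom_null \<tau> by (intro order_tendstoD(2)) auto
    ultimately show ?thesis
      using dev_subset[OF \<delta>(1)] eventually_ge_at_top[of "1::nat"]
    proof eventually_elim
      case (elim n)
      interpret prob_space "M n" using elim prob by blast
      \<comment> \<open>This also holds if \<open>dev n\<close> is nonmeasurable, since its measure is \<open>0\<close> then.\<close>
      have "measure (M n) (dev n) \<le> measure (M n) (low \<delta> n \<union> (\<Union>m\<in>{1..D}. mom m n))"
        using elim low_sets mom_sets by (intro finite_measure_mono) auto
      also have "\<dots> \<le> measure (M n) (low \<delta> n) + measure (M n) (\<Union>m\<in>{1..D}. mom m n)"
        using low_sets mom_sets by (intro measure_Un_le) auto
      also have "measure (M n) (\<Union>m\<in>{1..D}. mom m n) \<le> (\<Sum>m=1..D. measure (M n) (mom m n))"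
        using mom_sets by (intro finite_measure_subadditive_finite) auto
      finally show ?case using elim by simp
    qed
  qed
  hence "(\<lambda>n. measure (M n) (dev n)) \<longlonglongrightarrow> 0"
    by (intro order_tendstoI) (auto intro!: always_eventually less_le_trans[OF _ measure_nonneg])
  thus "(\<lambda>n. measure (M n) {\<omega> \<in> space (M n).
      dist (integral\<^sup>L (critical_measure (p n \<omega>)) f) (integral\<^sup>L circle_uniform f) > \<epsilon>}) \<longlonglongrightarrow> 0"
    unfolding dev_def .
qed

end
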